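(* Let $T\in\mathbb{R}_+^*$, let $l\in\mathbb{N}^*$ and let $\alpha\in\mathbb{R}$ with $l-1\le\alpha<l$. Let $y:\mathbb{R}\to\mathbb{R}$ be a continuous function whose Riemann-Liouville fractional derivative $\mathrm{D}_t^{\alpha}y$ of order $\alpha$ exists, and let $g$ be a modulating function of order $l$ on $[0,T]$. Then $$\int_0^T g(T-t)\,\mathrm{D}_t^{\alpha}y(t)\,dt=\int_0^T \mathrm{D}_t^{\alpha}g(t)\,y(T-t)\,dt .$$
   Context: $\mathbb{R}_+^*=(0,\infty)$ and $\mathbb{N}^*=\{1,2,3,\dots\}$. Riemann-Liouville fractional derivative (with base point $0$): for a continuous function $f$ and $\alpha\ge 0$ with $l-1\le\alpha<l$, $l\in\mathbb{N}^*$, for $t>0$, $$\mathrm{D}_t^{\alpha}f(t):=\frac{1}{\Gamma(l-\alpha)}\frac{d^l}{dt^l}\int_0^t (t-\tau)^{l-\alpha-1}f(\tau)\,d\tau ,$$ where $\Gamma$ is the Gamma function. For a function given only on $[0,T]$ the same formula is used for $t\in(0,T]$, with the derivative at $t=T$ taken from the left. Modulating function of order $l$ ($l\in\mathbb{N}^*$) on $[0,T]$: a function $g\in\mathcal{C}^l([0,T])$ such that $g^{(j)}(0)=g^{(j)}(T)=0$ for all $j=0,1,\dots,l-1$. Existence of $\mathrm{D}_t^\alpha y$ is understood so that the integral $\int_0^T g(T-t)\,\mathrm{D}_t^{\alpha}y(t)\,dt$ is well defined, i.e. its integrand is integrable on $(0,T)$. *)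

theory Defs
  imports "HOL-Analysis.Analysis"
begin

(* Derivatives are taken within S, so they are one-sided at an endpoint belonging to S.
   The value at x in S depends only on the restriction of f to S. *)
definition iter_deriv :: "real set \<Rightarrow> nat \<Rightarrow> (real \<Rightarrow> real) \<Rightarrow> real \<Rightarrow> real" where
  "iter_deriv S n f = ((\<lambda>h x. vector_derivative h (at x within S)) ^^ n) f"

definition times_differentiable_on :: "nat \<Rightarrow> (real \<Rightarrow> real) \<Rightarrow> real set \<Rightarrow> bool" where
  "times_differentiable_on n f S \<longleftrightarrow> (\<forall>k<n. iter_deriv S k f differentiable_on S)"

definition C_class_on :: "nat \<Rightarrow> (real \<Rightarrow> real) \<Rightarrow> real set \<Rightarrow> bool" where
  "C_class_on n f S \<longleftrightarrow> times_differentiable_on n f S \<and> continuous_on S (iter_deriv S n f)"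

(* For \<alpha> \<ge> 0 this is the unique l \<ge> 1 with l - 1 \<le> \<alpha> < l; an integer \<alpha> gives l = \<alpha> + 1. *)
definition RL_order :: "real \<Rightarrow> nat" where
  "RL_order \<alpha> = nat \<lfloor>\<alpha>\<rfloor> + 1"

definition RL_kernel_integral :: "real \<Rightarrow> (real \<Rightarrow> real) \<Rightarrow> real \<Rightarrow> real" where
  "RL_kernel_integral \<alpha> f t =
     (LINT \<tau>:{0<..<t}|lborel. (t - \<tau>) powr (real (RL_order \<alpha>) - \<alpha> - 1) * f \<tau>)"

(* Riemann-Liouville derivative with base point 0. S is the set of times considered:
   {0<..} for a function given on the whole line, {0<..T} for one given only on {0..T}
   (the derivative at T is then the left one). *)
definition RL_deriv :: "real set \<Rightarrow> real \<Rightarrow> (real \<Rightarrow> real) \<Rightarrow> real \<Rightarrow> real" where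
  "RL_deriv S \<alpha> f t =
     1 / Gamma (real (RL_order \<alpha>) - \<alpha>) * iter_deriv S (RL_order \<alpha>) (RL_kernel_integral \<alpha> f) t"

definition RL_deriv_exists :: "real set \<Rightarrow> real \<Rightarrow> (real \<Rightarrow> real) \<Rightarrow> bool" where
  "RL_deriv_exists S \<alpha> f \<longleftrightarrow>
     times_differentiable_on (RL_order \<alpha>) (RL_kernel_integral \<alpha> f) S"

definition modulating_function :: "nat \<Rightarrow> real \<Rightarrow> (real \<Rightarrow> real) \<Rightarrow> bool" where
  "modulating_function l T g \<longleftrightarrow>
     C_class_on l g {0..T} \<and>
     (\<forall>j<l. iter_deriv {0..T} j g 0 = 0 \<and> iter_deriv {0..T} j g T = 0)"

end

theory Submission
  imports Defs
begin

text \<open>Put \<open>\<beta> = l - \<alpha>\<close> and let \<open>K f (t)\<close> be the integral of \<open>s powr (\<beta> - 1) * f (t - s)\<close> over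
  \<open>0 < s < t\<close>, so that the fractional derivative is the \<open>l\<close>-th derivative of \<open>K f\<close> divided by
  \<open>Gamma \<beta>\<close>. Since \<open>g\<close> and its first \<open>l - 1\<close> derivatives vanish at \<open>0\<close>, differentiation commutes with
  \<open>K\<close> and the fractional derivative of \<open>g\<close> is \<open>K\<close> applied to the \<open>l\<close>-th derivative of \<open>g\<close>. On the
  other side, \<open>l\<close> integrations by parts move the derivatives from \<open>K y\<close> to \<open>g (T - t)\<close>, whose
  derivatives vanish at both ends; Fubini's theorem then exchanges the roles of the two functions.\<close>

section \<open>Successive derivatives as explicit lists of functions\<close>

definition deriv_chain :: "real set \<Rightarrow> nat \<Rightarrow> (nat \<Rightarrow> real \<Rightarrow> real) \<Rightarrow> bool" where
  "deriv_chain S l p \<longleftrightarrow>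
     (\<forall>j<l. \<forall>x\<in>S. (p j has_real_derivative p (Suc j) x) (at x within S)) \<and> continuous_on S (p l)"

lemma deriv_chainD:
  assumes "deriv_chain S l p" "j < l" "x \<in> S"
  shows "(p j has_real_derivative p (Suc j) x) (at x within S)"
  using assms by (auto simp: deriv_chain_def)

lemma deriv_chain_continuous_on:
  assumes "deriv_chain S l p" "j \<le> l"
  shows "continuous_on S (p j)"
proof (cases "j = l")
  case False
  then show ?thesis
    using assms deriv_chainD[OF assms(1), of j] by (intro DERIV_continuous_on[of S "p j" "p (Suc j)"]) auto
qed (use assms in \<open>auto simp: deriv_chain_def\<close>)

text \<open>Here lies the reason for working with explicit lists of derivatives: one list serves on
  every smaller set and can be damped or reflected termwise, whereas \<open>iter_deriv\<close> is
  tied to its set.\<close>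

lemma deriv_chain_subset:
  assumes "deriv_chain S l p" "R \<subseteq> S"
  shows "deriv_chain R l p"
  using assms unfolding deriv_chain_def
  by (meson DERIV_subset continuous_on_subset subsetD)

lemma times_differentiable_onD:
  assumes "times_differentiable_on n f S" "k < n" "x \<in> S"
  shows "(iter_deriv S k f has_real_derivative iter_deriv S (Suc k) f x) (at x within S)"
proof -
  have "iter_deriv S k f differentiable (at x within S)"
    using assms by (auto simp: times_differentiable_on_def differentiable_on_def)
  then show ?thesis
    by (simp add: vector_derivative_works has_real_derivative_iff_has_vector_derivative iter_deriv_def)
qed

lemma C_class_on_deriv_chain:
  assumes "C_class_on l f S"
  shows "deriv_chain S l (\<lambda>j. iter_deriv S j f)"
  using assms times_differentiable_onD by (auto simp: C_class_on_def deriv_chain_def)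

text \<open>A derivative within \<open>S\<close> is unique because the filter is nontrivial, and it
  only sees values on \<open>S\<close>. So agreement of \<open>f\<close> with \<open>q 0\<close> on
  \<open>S\<close> propagates by induction through all orders.\<close>

lemma iter_deriv_eqI:
  assumes "\<And>x. x \<in> S \<Longrightarrow> at x within S \<noteq> bot"
    and "\<And>j x. j < n \<Longrightarrow> x \<in> S \<Longrightarrow> (q j has_real_derivative q (Suc j) x) (at x within S)"
    and "\<And>x. x \<in> S \<Longrightarrow> f x = q 0 x" and "j \<le> n" "x \<in> S"
  shows "iter_deriv S j f x = q j x"
  using assms(4,5)
proof (induction j arbitrary: x)
  case (Suc j)
  have "(iter_deriv S j f has_real_derivative q (Suc j) x) (at x within S)"
  proof (rule has_field_derivative_transform_within[of "q j" _ x S 1])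
    show "(q j has_real_derivative q (Suc j) x) (at x within S)"
      using assms(2) Suc.prems by simp
  qed (use Suc in auto)
  then show ?case
    using vector_derivative_within[OF assms(1)[OF Suc.prems(2)]]
    by (simp add: has_real_derivative_iff_has_vector_derivative iter_deriv_def)
qed (use assms in \<open>auto simp: iter_deriv_def\<close>)

lemma times_differentiable_onI:
  assumes "\<And>x. x \<in> S \<Longrightarrow> at x within S \<noteq> bot"
    and "\<And>j x. j < n \<Longrightarrow> x \<in> S \<Longrightarrow> (q j has_real_derivative q (Suc j) x) (at x within S)"
    and "\<And>x. x \<in> S \<Longrightarrow> f x = q 0 x"
  shows "times_differentiable_on n f S"
  unfolding times_differentiable_on_def differentiable_on_def
proof (intro allI impI ballI)
  fix k x assume k: "k < n" "x \<in> S"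
  have "(iter_deriv S k f has_real_derivative q (Suc k) x) (at x within S)"
    by (rule has_field_derivative_transform_within[OF assms(2)[OF k] zero_less_one k(2)])
       (use iter_deriv_eqI[of S n q f k] assms k in auto)
  then show "iter_deriv S k f differentiable at x within S"
    using real_differentiable_def by blast
qed

section \<open>Damping a function near the origin\<close>

text \<open>If \<open>p\<close> lists the successive derivatives of a function \<open>u\<close>, then \<open>div_id p\<close> lists those of
  \<open>u(t) / t\<close>: the recursion is Leibniz' rule for \<open>t \<cdot> (u(t) / t)\<close>.\<close>

primrec div_id :: "(nat \<Rightarrow> real \<Rightarrow> real) \<Rightarrow> nat \<Rightarrow> real \<Rightarrow> real" where
  "div_id p 0 t = p 0 t / t"
| "div_id p (Suc j) t = (p (Suc j) t - real (Suc j) * div_id p j t) / t"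

text \<open>If \<open>p\<close> lists the derivatives of u, this lists those of (1 - e/t) u(t).
  Iterated m times it yields the factor (1 - e/t)^m, which has a zero of order m at e and tends to 1
  as e tends to 0.\<close>

definition damp :: "real \<Rightarrow> (nat \<Rightarrow> real \<Rightarrow> real) \<Rightarrow> nat \<Rightarrow> real \<Rightarrow> real" where
  "damp e p j t = p j t - e * div_id p j t"

lemma damp_iter_Suc:
  "(damp e ^^ Suc m) p j t = (damp e ^^ m) p j t - e * div_id ((damp e ^^ m) p) j t"
  unfolding funpow.simps comp_def by (rule damp_def)

lemma div_id_deriv:
  assumes "\<And>i. i \<le> j \<Longrightarrow> (p i has_real_derivative p (Suc i) x) (at x within S)" "x \<noteq> 0"
  shows "(div_id p j has_real_derivative div_id p (Suc j) x) (at x within S)"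
  using assms(1)
proof (induction j)
  case 0
  have "((\<lambda>t. p 0 t / t) has_real_derivative (p 1 x * x - p 0 x * 1) / (x * x)) (at x within S)"
    using 0[of 0] assms(2) by (intro DERIV_divide DERIV_ident) auto
  then show ?case using assms(2) by (simp add: field_simps)
next
  case (Suc j)
  let ?D = "div_id p (Suc j) x"
  have IH: "(div_id p j has_real_derivative ?D) (at x within S)"
    by (rule Suc.IH) (simp add: Suc.prems)
  have "((\<lambda>t. (p (Suc j) t - real (Suc j) * div_id p j t) / t) has_real_derivative
      ((p (Suc (Suc j)) x - real (Suc j) * ?D) * x
        - (p (Suc j) x - real (Suc j) * div_id p j x) * 1) / (x * x)) (at x within S)"
    by (rule DERIV_divide[OF DERIV_diff[OF Suc.prems[OF order_refl] DERIV_cmult[OF IH]] DERIV_ident assms(2)])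
  \<comment> \<open>By the recursion the numerator equals \<open>x * ?D\<close>, so the quotient
    rule subtracts one further \<open>?D / x\<close>. This raises the coefficient of
    \<open>?D\<close> from j + 1 to j + 2.\<close>
  also have "p (Suc j) x - real (Suc j) * div_id p j x = x * ?D"
    using assms(2) by simp
  also have "((p (Suc (Suc j)) x - real (Suc j) * ?D) * x - x * ?D * 1) / (x * x)
      = (p (Suc (Suc j)) x - real (Suc (Suc j)) * ?D) / x"
    using assms(2) by (simp add: divide_simps del: div_id.simps) (simp add: algebra_simps del: div_id.simps)
  also have "\<dots> = div_id p (Suc (Suc j)) x"
    by (rule div_id.simps(2)[symmetric])
  also have "(\<lambda>t. (p (Suc j) t - real (Suc j) * div_id p j t) / t) = div_id p (Suc j)"
    by (simp add: fun_eq_iff)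
  finally show ?case .
qed

lemma div_id_continuous_on:
  assumes "\<And>i. i \<le> j \<Longrightarrow> continuous_on S (p i)" "0 \<notin> S"
  shows "continuous_on S (div_id p j)"
  using assms(1)
proof (induction j)
  case 0
  then show ?case using assms(2) by (auto intro!: continuous_intros)
next
  case (Suc j)
  then have "continuous_on S (div_id p j)" "continuous_on S (p (Suc j))" by auto
  then show ?case using assms(2) by (auto simp del: of_nat_Suc intro!: continuous_intros)
qed

lemma deriv_chain_damp:
  assumes "deriv_chain S l p" "0 \<notin> S"
  shows "deriv_chain S l (damp e p)"
  unfolding deriv_chain_def
proof (intro conjI allI impI ballI)
  fix j x assume j: "j < l" "x \<in> S"
  then have "(div_id p j has_real_derivative div_id p (Suc j) x) (at x within S)"
    using assms by (intro div_id_deriv deriv_chainD[OF assms(1)]) auto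
  then show "(damp e p j has_real_derivative damp e p (Suc j) x) (at x within S)"
    unfolding damp_def using deriv_chainD[OF assms(1) j]
    by (intro DERIV_diff DERIV_cmult)
next
  show "continuous_on S (damp e p l)"
    unfolding damp_def using assms
    by (intro continuous_intros div_id_continuous_on deriv_chain_continuous_on[OF assms(1)]) auto
qed

lemma deriv_chain_damp_iter:
  assumes "deriv_chain S l p" "0 \<notin> S"
  shows "deriv_chain S l ((damp e ^^ m) p)"
  using assms by (induction m) (auto intro: deriv_chain_damp)

text \<open>Each step of the recursion divides by \<open>x\<close> and so costs the one power by
  which the exponent \<open>l - j\<close> drops. The factor \<open>x\<close> stays on the left
  because at \<open>j = l\<close> the bound for the quotient itself would need the exponent
  -1.\<close>

lemma div_id_bound:
  assumes "\<And>i. i \<le> j \<Longrightarrow> \<bar>p i x\<bar> \<le> C * x ^ (l - i)" "0 < x" "0 \<le> C" "j \<le> l"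
  shows "x * \<bar>div_id p j x\<bar> \<le> C * fact (Suc j) * x ^ (l - j)"
  using assms(1,4)
proof (induction j)
  case 0
  from "0.prems"(1)[of 0] show ?case using assms(2) by (simp add: abs_divide)
next
  case (Suc j)
  have l: "l - j = Suc (l - Suc j)" using Suc.prems(2) by simp
  have IH: "\<bar>div_id p j x\<bar> \<le> C * fact (Suc j) * x ^ (l - Suc j)"
  proof -
    have "x * \<bar>div_id p j x\<bar> \<le> x * (C * fact (Suc j) * x ^ (l - Suc j))"
      using Suc.IH Suc.prems by (simp add: l mult_ac)
    then show ?thesis using assms(2) by (simp only: mult_le_cancel_left_pos)
  qed
  have f1: "1 \<le> (fact (Suc j) :: real)" by (rule fact_ge_1)
  have "x * \<bar>div_id p (Suc j) x\<bar> = \<bar>p (Suc j) x - real (Suc j) * div_id p j x\<bar>"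
    using assms(2) by (simp add: abs_divide)
  also have "\<dots> \<le> \<bar>p (Suc j) x\<bar> + real (Suc j) * \<bar>div_id p j x\<bar>"
    by (rule order_trans[OF abs_triangle_ineq4]) (simp add: abs_mult)
  also have "\<dots> \<le> C * x ^ (l - Suc j) + real (Suc j) * (C * fact (Suc j) * x ^ (l - Suc j))"
    using IH Suc.prems(1)[of "Suc j"] by (intro add_mono mult_left_mono) auto
  also have "\<dots> = C * x ^ (l - Suc j) * (1 + real (Suc j) * fact (Suc j))"
    by (simp add: algebra_simps)
  \<comment> \<open>The factorial closes the recursion, as 1 + (j+1) (j+1)! is at most
    (j+2)!.\<close>
  also have "\<dots> \<le> C * x ^ (l - Suc j) * fact (Suc (Suc j))"
    using assms(2,3) f1
    by (intro mult_left_mono mult_nonneg_nonneg)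
       (simp_all only: fact_Suc[of "Suc j"] of_nat_Suc zero_le_power less_imp_le, auto simp: algebra_simps)
  finally show ?case by (simp only: mult_ac)
qed

text \<open>Since \<open>e \<le> x\<close>, the correction \<open>e * div_id p j x\<close> is at
  most \<open>x * div_id p j x\<close> in absolute value, which \<open>div_id_bound\<close>
  controls. The new constant does not depend on \<open>e\<close>, so the bound can be iterated and
  later used for domination.\<close>

lemma damp_bound:
  assumes "\<And>i. i \<le> l \<Longrightarrow> \<bar>p i x\<bar> \<le> C * x ^ (l - i)" "0 < e" "e \<le> x" "0 \<le> C" "j \<le> l"
  shows "\<bar>damp e p j x\<bar> \<le> C * (1 + fact (Suc l)) * x ^ (l - j)"
proof -
  have "\<bar>damp e p j x\<bar> \<le> \<bar>p j x\<bar> + e * \<bar>div_id p j x\<bar>"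
    unfolding damp_def using assms(2)
    by (intro order_trans[OF abs_triangle_ineq4]) (simp add: abs_mult)
  also have "e * \<bar>div_id p j x\<bar> \<le> x * \<bar>div_id p j x\<bar>"
    using assms by (intro mult_right_mono) auto
  also have "\<dots> \<le> C * fact (Suc j) * x ^ (l - j)"
    using assms by (intro div_id_bound) auto
  also have "\<dots> \<le> C * fact (Suc l) * x ^ (l - j)"
    using assms by (intro mult_right_mono mult_left_mono fact_mono) auto
  also have "\<bar>p j x\<bar> \<le> C * x ^ (l - j)" using assms by auto
  finally show ?thesis by (simp add: algebra_simps)
qed

lemma damp_iter_bound:
  assumes "\<And>i. i \<le> l \<Longrightarrow> \<bar>p i x\<bar> \<le> C * x ^ (l - i)" "0 < e" "e \<le> x" "0 \<le> C" "j \<le> l"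
  shows "\<bar>(damp e ^^ m) p j x\<bar> \<le> C * (1 + fact (Suc l)) ^ m * x ^ (l - j)"
  using assms(5)
proof (induction m arbitrary: j)
  case (Suc m)
  have "\<bar>damp e ((damp e ^^ m) p) j x\<bar>
      \<le> (C * (1 + fact (Suc l)) ^ m) * (1 + fact (Suc l)) * x ^ (l - j)"
    using Suc assms by (intro damp_bound) auto
  then show ?case by (simp add: mult_ac)
qed (use assms in auto)

lemma div_id_tendsto:
  assumes "\<And>i. (\<lambda>n. P n i x) \<longlonglongrightarrow> p i x" "x \<noteq> 0"
  shows "(\<lambda>n. div_id (P n) j x) \<longlonglongrightarrow> div_id p j x"
proof (induction j)
  case 0
  then show ?case using assms by (auto intro!: tendsto_intros)
next
  case (Suc j)
  then show ?case using assms by (auto simp del: of_nat_Suc intro!: tendsto_intros)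
qed

text \<open>Away from 0 each \<open>div_id\<close> depends continuously on finitely many entries of
  the list, so it converges, and its factor \<open>e n\<close> tends to 0.\<close>

lemma damp_iter_tendsto:
  assumes "e \<longlonglongrightarrow> 0" "x \<noteq> 0"
  shows "(\<lambda>n. (damp (e n) ^^ m) p j x) \<longlonglongrightarrow> p j x"
proof (induction m arbitrary: j)
  case (Suc m)
  have "(\<lambda>n. (damp (e n) ^^ m) p j x - e n * div_id ((damp (e n) ^^ m) p) j x)
      \<longlonglongrightarrow> p j x - 0 * div_id p j x"
    using Suc assms by (intro tendsto_intros div_id_tendsto) auto
  then show ?case unfolding damp_iter_Suc by simp
qed auto

lemma div_id_zero:
  assumes "\<And>i. i < m \<Longrightarrow> p i x = 0" "j < m"
  shows "div_id p j x = 0"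
  using assms(2) by (induction j) (auto simp: assms(1))

lemma damp_iter_zero:
  assumes "\<And>i. i < l \<Longrightarrow> p i x = 0" "j < l"
  shows "(damp e ^^ m) p j x = 0"
  using assms(2)
proof (induction m arbitrary: j)
  case (Suc m)
  have "div_id ((damp e ^^ m) p) j x = 0" using Suc by (intro div_id_zero[of l]) auto
  then show ?case using Suc unfolding damp_iter_Suc by simp
qed (use assms in auto)

text \<open>Each multiplication by 1 - e/t raises the order of the zero at \<open>e\<close> by
  one.\<close>

lemma damp_iter_zero_at:
  assumes "e \<noteq> 0" "j < m"
  shows "(damp e ^^ m) p j e = 0"
  using assms(2)
proof (induction m arbitrary: j)
  case (Suc m)
  let ?q = "(damp e ^^ m) p"
  have "damp e ?q j e = 0"
  proof (cases j)
    case 0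
    then show ?thesis using assms(1) by (simp add: damp_def)
  next
    \<comment> \<open>At the point \<open>e\<close> the two terms \<open>?q j e\<close> cancel,
      leaving a multiple of \<open>div_id ?q i e\<close>. That involves only entries of index at
      most \<open>i < m\<close>, which vanish by induction.\<close>
    case (Suc i)
    then have "div_id ?q i e = 0"
      using Suc.IH \<open>j < Suc m\<close> by (intro div_id_zero[of m]) auto
    then show ?thesis using assms(1) by (simp add: damp_def Suc)
  qed
  then show ?case by simp
qed auto

lemma damp_iter_0: "x \<noteq> 0 \<Longrightarrow> (damp e ^^ m) p 0 x = (1 - e / x) ^ m * p 0 x"
  by (induction m) (auto simp: damp_iter_Suc field_simps simp del: funpow.simps(2))

text \<open>A Taylor estimate: \<open>p l\<close> is bounded by compactness, and descending from
  \<open>j = l\<close> the mean value inequality on \<open>{0..x}\<close> gains one power of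
  \<open>x\<close> per order because \<open>p j 0 = 0\<close>.\<close>

lemma deriv_chain_vanishing_bound:
  assumes "deriv_chain {0..T} l p" "\<And>j. j < l \<Longrightarrow> p j 0 = 0"
  obtains C where "C \<ge> 0" "\<And>j x. j \<le> l \<Longrightarrow> x \<in> {0..T} \<Longrightarrow> \<bar>p j x\<bar> \<le> C * x ^ (l - j)"
proof -
  have "bounded (p l ` {0..T})"
    using assms(1) by (intro compact_imp_bounded compact_continuous_image) (auto simp: deriv_chain_def)
  then obtain C where C: "C > 0" "\<And>x. x \<in> {0..T} \<Longrightarrow> \<bar>p l x\<bar> \<le> C"
    by (auto simp: bounded_pos)
  have "\<bar>p j x\<bar> \<le> C * x ^ (l - j)" if "j \<le> l" "x \<in> {0..T}" for j x
    using that
  proof (induction arbitrary: x rule: inc_induct)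
    case (step j)
    have "norm (p j x - p j 0) \<le> C * x ^ (l - Suc j) * norm (x - 0)"
    proof (rule field_differentiable_bound[of "{0..x}" _ "p (Suc j)"])
      fix z assume z: "z \<in> {0..x}"
      show "(p j has_real_derivative p (Suc j) z) (at z within {0..x})"
        using z step.prems step.hyps by (intro DERIV_subset[OF deriv_chainD[OF assms(1)]]) auto
      have "norm (p (Suc j) z) \<le> C * z ^ (l - Suc j)" using step.IH[of z] z step.prems by auto
      also have "\<dots> \<le> C * x ^ (l - Suc j)"
        using z C(1) by (intro mult_left_mono power_mono) auto
      finally show "norm (p (Suc j) z) \<le> C * x ^ (l - Suc j)" .
    qed (use step.prems in auto)
    moreover have "l - j = Suc (l - Suc j)" using step.hyps by simp
    ultimately show ?case using assms(2)[of j] step.hyps step.prems by (simp add: mult_ac)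
  qed (use C in auto)
  then show ?thesis using C(1) by (intro that[of C]) auto
qed

section \<open>Integration by parts against a modulating function\<close>

lemma set_integrable_Ioo_continuous:
  fixes f :: "real \<Rightarrow> real"
  assumes "continuous_on {a..b} f"
  shows "set_integrable lborel {a<..<b} f"
  by (rule set_integrable_subset[of lborel "{a..b}"])
     (use borel_integrable_compact[OF compact_Icc assms] in \<open>auto simp: set_integrable_def\<close>)

lemma integral_by_parts_iterated:
  fixes p f :: "nat \<Rightarrow> real \<Rightarrow> real"
  assumes "a \<le> b" "0 < l" "deriv_chain {a..b} l p"
    and "\<And>j x. j < l \<Longrightarrow> x \<in> {a..b} \<Longrightarrow> (f j has_real_derivative f (Suc j) x) (at x within {a..b})"
    and "\<And>j. j < l \<Longrightarrow> p j a = 0" "\<And>j. j < l \<Longrightarrow> p j b = 0"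
    and "set_integrable lborel {a<..<b} (\<lambda>x. p 0 x * f l x)"
  shows "(LINT x:{a<..<b}|lborel. p 0 x * f l x) = (-1) ^ l * (LINT x:{a<..<b}|lborel. p l x * f 0 x)"
proof -
  \<comment> \<open>\<open>B\<close> collects the boundary terms of all \<open>l\<close>
    integrations by parts. Its derivative telescopes, so the fundamental theorem is applied only
    once.\<close>
  define B where "B x = (\<Sum>j<l. (-1) ^ j * (p j x * f (l - 1 - j) x))" for x
  have B: "(B has_real_derivative p 0 x * f l x - (-1) ^ l * (p l x * f 0 x)) (at x within {a..b})"
    if x: "x \<in> {a..b}" for x
  proof -
    define c where "c j = (-1) ^ j * (p j x * f (l - j) x)" for j
    have "(B has_real_derivative (\<Sum>j<l. (-1) ^ j * (p (Suc j) x * f (l - 1 - j) x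
        + f (Suc (l - 1 - j)) x * p j x))) (at x within {a..b})"
      unfolding B_def using x assms(2)
      by (intro DERIV_sum DERIV_cmult DERIV_mult deriv_chainD[OF assms(3)] assms(4)) auto
    also have "(\<Sum>j<l. (-1) ^ j * (p (Suc j) x * f (l - 1 - j) x + f (Suc (l - 1 - j)) x * p j x))
        = (\<Sum>j<l. c j - c (Suc j))"
    proof (rule sum.cong)
      fix j assume "j \<in> {..<l}"
      then have "Suc (l - 1 - j) = l - j" "l - 1 - j = l - Suc j" by auto
      then show "(-1) ^ j * (p (Suc j) x * f (l - 1 - j) x + f (Suc (l - 1 - j)) x * p j x)
          = c j - c (Suc j)"
        by (simp add: c_def algebra_simps)
    qed simp
    also have "\<dots> = p 0 x * f l x - (-1) ^ l * (p l x * f 0 x)"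
      by (subst sum_lessThan_telescope') (simp add: c_def)
    finally show ?thesis .
  qed
  \<comment> \<open>For the gauge integral the fundamental theorem asks for no continuity of the
    derivative, hence for none of \<open>f l\<close>.\<close>
  have "((\<lambda>x. p 0 x * f l x - (-1) ^ l * (p l x * f 0 x)) has_integral B b - B a) {a..b}"
    using B assms(1)
    by (intro fundamental_theorem_of_calculus) (auto simp: has_real_derivative_iff_has_vector_derivative)
  moreover have "B b = 0" "B a = 0" using assms(5,6) by (auto simp: B_def)
  ultimately have "((\<lambda>x. p 0 x * f l x - (-1) ^ l * (p l x * f 0 x)) has_integral 0) {a<..<b}"
    by (simp add: has_integral_Icc_iff_Ioo)
  moreover have "continuous_on {a..b} (f 0)"
    using assms(2,4) by (intro DERIV_continuous_on[of _ _ "f 1"]) auto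
  then have "set_integrable lborel {a<..<b} (\<lambda>x. p l x * f 0 x)"
    using assms(3) by (intro set_integrable_Ioo_continuous continuous_intros)
      (auto simp: deriv_chain_def)
  \<comment> \<open>Both terms are Lebesgue integrable, so their gauge and Lebesgue integrals agree
    and the integral of the difference splits.\<close>
  note int = set_borel_integral_eq_integral[OF assms(7)] set_borel_integral_eq_integral[OF this]
  then have "((\<lambda>x. p 0 x * f l x - (-1) ^ l * (p l x * f 0 x)) has_integral
      ((LINT x:{a<..<b}|lborel. p 0 x * f l x) - (-1) ^ l * (LINT x:{a<..<b}|lborel. p l x * f 0 x))) {a<..<b}"
    by (intro has_integral_diff has_integral_mult_right) (auto simp: has_integral_integral)
  ultimately have "(LINT x:{a<..<b}|lborel. p 0 x * f l x)
      - (-1) ^ l * (LINT x:{a<..<b}|lborel. p l x * f 0 x) = 0"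
    by (rule has_integral_unique[rotated])
  then show ?thesis by simp
qed

text \<open>Nothing is known about \<open>f j\<close> near \<open>0\<close> for \<open>j > 0\<close>, so boundary terms at \<open>0\<close> cannot be estimated
  directly. The factor \<open>(1 - e / x) ^ l\<close> removes the boundary terms at \<open>e\<close>, and the vanishing of
  \<open>p\<close> at \<open>0\<close> keeps the \<open>l\<close>-th derivative of the product bounded uniformly in \<open>e\<close>.\<close>

lemma integral_by_parts_vanishing:
  fixes p f :: "nat \<Rightarrow> real \<Rightarrow> real"
  assumes "0 < T" "0 < l" "deriv_chain {0..T} l p"
    and f: "\<And>j x. j < l \<Longrightarrow> x \<in> {0<..T} \<Longrightarrow> (f j has_real_derivative f (Suc j) x) (at x within {0<..T})"
    and p0: "\<And>j. j < l \<Longrightarrow> p j 0 = 0" "\<And>j. j < l \<Longrightarrow> p j T = 0"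
    and M: "\<And>x. x \<in> {0<..T} \<Longrightarrow> \<bar>f 0 x\<bar> \<le> M"
    and int: "set_integrable lborel {0<..<T} (\<lambda>x. p 0 x * f l x)"
  shows "(LINT x:{0<..<T}|lborel. p 0 x * f l x) = (-1) ^ l * (LINT x:{0<..<T}|lborel. p l x * f 0 x)"
proof -
  \<comment> \<open>The cut-off is T/(n+2), which lies strictly inside the interval already for
    \<open>n = 0\<close>.\<close>
  define e where "e n = T * inverse (real (Suc (Suc n)))" for n
  have e: "0 < e n" "e n < T" for n
    using assms(1) by (auto simp: e_def field_simps intro: add_pos_nonneg)
  have e0: "e \<longlonglongrightarrow> 0"
    unfolding e_def
    using tendsto_mult_left[OF LIMSEQ_Suc[OF LIMSEQ_inverse_real_of_nat], of T] by simp
  define W where "W n = (damp (e n) ^^ l) p" for n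
  obtain C where C: "C \<ge> 0" "\<And>j x. j \<le> l \<Longrightarrow> x \<in> {0..T} \<Longrightarrow> \<bar>p j x\<bar> \<le> C * x ^ (l - j)"
    using deriv_chain_vanishing_bound[OF assms(3) p0(1)] by blast
  have chain: "deriv_chain {e n..T} l (W n)" for n
    unfolding W_def using e[of n]
    by (intro deriv_chain_damp_iter deriv_chain_subset[OF assms(3)]) auto
  have f': "(f j has_real_derivative f (Suc j) x) (at x within {e n..T})"
    if "j < l" "x \<in> {e n..T}" for j x n
    using e[of n] that by (intro DERIV_subset[OF f]) auto
  have cont_f: "continuous_on {0<..T} (f 0)"
    using assms(2) f by (intro DERIV_continuous_on[of _ _ "f 1"]) auto
  define L where "L n x = indicator {e n<..<T} x *\<^sub>R (W n 0 x * f l x)" for n x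
  define R where "R n x = indicator {e n<..<T} x *\<^sub>R (W n l x * f 0 x)" for n x
  define L' where "L' x = indicator {0<..<T} x *\<^sub>R (p 0 x * f l x)" for x
  define R' where "R' x = indicator {0<..<T} x *\<^sub>R (p l x * f 0 x)" for x
  have intL': "integrable lborel L'" using int by (simp add: L'_def[abs_def] set_integrable_def)
  then have mL'[measurable]: "L' \<in> borel_measurable lborel" by auto
  \<comment> \<open>The left integrand is \<open>L'\<close> times an explicit factor. Measurability
    is inherited from \<open>L'\<close>, and since the factor lies in [0,1] on
    \<open>{e n<..<T}\<close>, the given integrable function \<open>L'\<close> itself
    dominates.\<close>
  have L: "L n x = indicator {e n<..<T} x * (1 - e n / x) ^ l * L' x" for n x
    using e[of n] by (auto simp: L_def L'_def W_def damp_iter_0 indicator_def)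
  have mL[measurable]: "L n \<in> borel_measurable lborel" for n
    unfolding L[abs_def] by measurable
  have bL: "norm (L n x) \<le> norm (L' x)" for n x
  proof (cases "x \<in> {e n<..<T}")
    case True
    then have "0 \<le> 1 - e n / x" "1 - e n / x \<le> 1" using e[of n] by (auto simp: field_simps)
    then have "\<bar>(1 - e n / x) ^ l\<bar> \<le> 1" by (simp add: power_le_one)
    then show ?thesis unfolding L using True
      by (simp add: abs_mult mult_left_le_one_le)
  qed (auto simp: L)
  have intL: "integrable lborel (L n)" for n
    by (rule Bochner_Integration.integrable_bound[OF intL']) (use bL in auto)
  have ev: "\<forall>\<^sub>F n in sequentially. x \<in> {e n<..<T} \<longleftrightarrow> x \<in> {0<..<T}" for x
  proof (cases "x > 0")
    case True
    show ?thesis using order_tendstoD(2)[OF e0 True] by eventually_elim (use True in auto)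
  next
    case False
    then have "x \<in> {e n<..<T} \<longleftrightarrow> x \<in> {0<..<T}" for n using e(1)[of n] by auto
    then show ?thesis by (intro always_eventually allI)
  qed
  have lim: "(\<lambda>n. indicator {e n<..<T} x *\<^sub>R (W n j x * c)) \<longlonglongrightarrow> indicator {0<..<T} x *\<^sub>R (p j x * c)"
    for x j c
  proof (cases "x \<in> {0<..<T}")
    case True
    have "(\<lambda>n. W n j x * c) \<longlonglongrightarrow> p j x * c"
      unfolding W_def using True e0 by (intro tendsto_intros damp_iter_tendsto) auto
    moreover have "\<forall>\<^sub>F n in sequentially. W n j x * c = indicator {e n<..<T} x *\<^sub>R (W n j x * c)"
      using ev[of x] by eventually_elim (use True in auto)
    ultimately show ?thesis using True by (auto intro: Lim_transform_eventually)
  next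
    case False
    have "\<forall>\<^sub>F n in sequentially. 0 = indicator {e n<..<T} x *\<^sub>R (W n j x * c)"
      using ev[of x] by eventually_elim (use False in auto)
    then show ?thesis using False by (auto intro: Lim_transform_eventually[OF tendsto_const])
  qed
  have limL: "(\<lambda>n. integral\<^sup>L lborel (L n)) \<longlonglongrightarrow> integral\<^sup>L lborel L'"
  proof (rule integral_dominated_convergence[where w = "\<lambda>x. norm (L' x)"])
    show "AE x in lborel. (\<lambda>n. L n x) \<longlonglongrightarrow> L' x"
      unfolding L_def L'_def by (intro AE_I2 lim)
    show "AE x in lborel. norm (L n x) \<le> norm (L' x)" for n
      by (intro AE_I2 bL)
  qed (rule mL' mL integrable_norm[OF intL'])+
  \<comment> \<open>At \<open>j = l\<close> the bound on the damped list contains x^0 = 1. So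
    \<open>K\<close> is its constant after \<open>l\<close> dampings times the bound
    \<open>M\<close> on \<open>f 0\<close>, the same for every \<open>n\<close>.\<close>
  define K where "K = C * (1 + fact (Suc l)) ^ l * M"
  have "0 \<le> M" using M[of T] assms(1) by auto
  have bR: "norm (R n x) \<le> K * indicator {0<..<T} x" for n x
  proof (cases "x \<in> {e n<..<T}")
    case True
    have "\<bar>W n l x\<bar> \<le> C * (1 + fact (Suc l)) ^ l * x ^ (l - l)"
      unfolding W_def using True e[of n] C by (intro damp_iter_bound) auto
    moreover have "\<bar>f 0 x\<bar> \<le> M" using True e[of n] by (intro M) auto
    ultimately have "\<bar>W n l x * f 0 x\<bar> \<le> K"
      unfolding abs_mult K_def using C(1) by (intro mult_mono) auto
    then show ?thesis using True e[of n] by (auto simp: R_def)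
  next
    case False
    then show ?thesis using C(1) \<open>0 \<le> M\<close> by (auto simp: R_def K_def indicator_def)
  qed
  have mR: "R n \<in> borel_measurable lborel" for n
  proof -
    have "continuous_on {e n<..<T} (\<lambda>x. W n l x * f 0 x)"
      using e[of n] deriv_chain_continuous_on[OF chain, of l n]
      by (intro continuous_intros continuous_on_subset[OF cont_f])
         (auto intro: continuous_on_subset)
    then show ?thesis unfolding R_def
      by (simp del: real_scaleR_def add: borel_measurable_continuous_on_indicator)
  qed
  have mR': "R' \<in> borel_measurable lborel"
  proof -
    have "continuous_on {0<..<T} (\<lambda>x. p l x * f 0 x)"
      using deriv_chain_continuous_on[OF assms(3), of l]
      by (intro continuous_intros continuous_on_subset[OF cont_f])
         (auto intro: continuous_on_subset)
    then show ?thesis unfolding R'_def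
      by (simp del: real_scaleR_def add: borel_measurable_continuous_on_indicator)
  qed
  have limR: "(\<lambda>n. integral\<^sup>L lborel (R n)) \<longlonglongrightarrow> integral\<^sup>L lborel R'"
  proof (rule integral_dominated_convergence[where w = "\<lambda>x. K * indicator {0<..<T} x"])
    show "AE x in lborel. (\<lambda>n. R n x) \<longlonglongrightarrow> R' x"
      unfolding R_def R'_def by (intro AE_I2 lim)
    show "AE x in lborel. norm (R n x) \<le> K * indicator {0<..<T} x" for n
      by (intro AE_I2 bR)
    show "integrable lborel (\<lambda>x. K * indicator {0<..<T} x)"
      using assms(1) by simp
  qed (rule mR mR')+
  have "integral\<^sup>L lborel (L n) = (-1) ^ l * integral\<^sup>L lborel (R n)" for n
  proof -
    \<comment> \<open>On \<open>{e n..T}\<close> the list \<open>W n\<close> vanishes at the left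
      end through the damping and at the right end because \<open>p\<close> does, so no boundary
      term survives.\<close>
    have "(LINT x:{e n<..<T}|lborel. W n 0 x * f l x) = (-1) ^ l * (LINT x:{e n<..<T}|lborel. W n l x * f 0 x)"
    proof (rule integral_by_parts_iterated[OF _ assms(2) chain])
      show "(f j has_real_derivative f (Suc j) x) (at x within {e n..T})"
        if "j < l" "x \<in> {e n..T}" for j x
        using f' that .
      show "W n j (e n) = 0" if "j < l" for j
        unfolding W_def using e[of n] that by (intro damp_iter_zero_at) auto
      show "W n j T = 0" if "j < l" for j
        unfolding W_def using that p0 by (intro damp_iter_zero) auto
      show "set_integrable lborel {e n<..<T} (\<lambda>x. W n 0 x * f l x)"
        using intL[of n] by (simp add: L_def[abs_def] set_integrable_def)
    qed (use e[of n] in auto)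
    then show ?thesis by (simp add: L_def[abs_def] R_def[abs_def] set_lebesgue_integral_def)
  qed
  then have "(\<lambda>n. integral\<^sup>L lborel (L n)) \<longlonglongrightarrow> (-1) ^ l * integral\<^sup>L lborel R'"
    using limR by (auto intro!: tendsto_intros)
  then have "integral\<^sup>L lborel L' = (-1) ^ l * integral\<^sup>L lborel R'"
    using limL LIMSEQ_unique by blast
  then show ?thesis by (simp add: L'_def[abs_def] R'_def[abs_def] set_lebesgue_integral_def)
qed

section \<open>Convolution with the weakly singular kernel\<close>

text \<open>The Riemann-Liouville integral without its Gamma factor, after the substitution s = t -
  \<tau>. The singularity then sits at the fixed point \<open>s = 0\<close>, and inside the
  integrand \<open>t\<close> occurs only in the argument of \<open>f\<close>.\<close>

definition kern :: "real \<Rightarrow> (real \<Rightarrow> real) \<Rightarrow> real \<Rightarrow> real" where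
  "kern \<beta> f t = (LINT s:{0<..<t}|lborel. s powr (\<beta> - 1) * f (t - s))"

lemma kern_cong: "(\<And>x. x \<in> {0<..<t} \<Longrightarrow> f x = h x) \<Longrightarrow> kern \<beta> f t = kern \<beta> h t"
  unfolding kern_def by (intro set_lebesgue_integral_cong) auto

lemma RL_kernel_integral_eq_kern: "RL_kernel_integral \<alpha> f t = kern (real (RL_order \<alpha>) - \<alpha>) f t"
proof -
  have "indicator {0<..<t} (t + -1 * s) = (indicator {0<..<t} s :: real)" for s
    by (auto simp: indicator_def)
  then show ?thesis
    unfolding RL_kernel_integral_def kern_def set_lebesgue_integral_def
    by (subst lborel_integral_real_affine[where c = "-1" and t = t]) auto
qed

lemma set_integrable_powr_Ioo:
  fixes \<beta> T :: real
  assumes "0 < \<beta>"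
  shows "set_integrable lborel {0<..<T} (\<lambda>s. s powr (\<beta> - 1))"
proof (cases "T \<ge> 0")
  case True
  have "(\<lambda>s. s powr (\<beta> - 1)) absolutely_integrable_on {0<..T}"
    using assms True by (intro nonnegative_absolutely_integrable_1 integrable_on_powr_from_0') auto
  then have "(\<lambda>s. s powr (\<beta> - 1)) absolutely_integrable_on {0<..<T}"
    by (rule set_integrable_subset) auto
  \<comment> \<open>The integrability was obtained for Lebesgue measure, the completion of
    \<open>lborel\<close>; as the integrand is Borel measurable it transfers back.\<close>
  then show ?thesis
    unfolding set_integrable_def by (subst (asm) integrable_completion) auto
qed (simp add: set_integrable_def)

lemma continuous_on_Icc_bounded:
  fixes f :: "real \<Rightarrow> real"
  assumes "continuous_on {0..T} f"
  obtains M where "M > 0" "\<And>x. x \<in> {0..T} \<Longrightarrow> \<bar>f x\<bar> \<le> M"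
proof -
  have "bounded (f ` {0..T})"
    using assms by (intro compact_imp_bounded compact_continuous_image) auto
  then show ?thesis using that by (auto simp: bounded_pos)
qed

lemma kern_integrable:
  fixes f :: "real \<Rightarrow> real"
  assumes "0 < \<beta>" "t \<le> T" "continuous_on {0..T} f"
  shows "set_integrable lborel {0<..<t} (\<lambda>s. s powr (\<beta> - 1) * f (t - s))"
proof -
  obtain M where M: "M > 0" "\<And>x. x \<in> {0..T} \<Longrightarrow> \<bar>f x\<bar> \<le> M"
    using continuous_on_Icc_bounded[OF assms(3)] by blast
  have "continuous_on {0<..<t} (\<lambda>s. f (t - s))"
    by (rule continuous_on_compose2[OF assms(3)]) (use assms(2) in \<open>auto intro!: continuous_intros\<close>)
  then have m: "(\<lambda>s. indicator {0<..<t} s *\<^sub>R (s powr (\<beta> - 1) * f (t - s))) \<in> borel_measurable borel"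
    by (intro borel_measurable_continuous_on_indicator continuous_intros) auto
  have b: "norm (indicator {0<..<t} s *\<^sub>R (s powr (\<beta> - 1) * f (t - s)))
      \<le> norm (M * (indicator {0<..<t} s *\<^sub>R s powr (\<beta> - 1)))" for s
    using M(2)[of "t - s"] M(1) assms(2)
    by (auto simp: indicator_def abs_mult mult.commute[of M] intro!: mult_left_mono)
  show ?thesis
    unfolding set_integrable_def
  proof (rule Bochner_Integration.integrable_bound)
    show "integrable lborel (\<lambda>s. M * (indicator {0<..<t} s *\<^sub>R s powr (\<beta> - 1)))"
      using set_integrable_powr_Ioo[OF assms(1), of t]
      unfolding set_integrable_def by (rule integrable_mult_right)
  qed (use m b in auto)
qed

text \<open>Integrating the kernel over all of \<open>{0<..<T}\<close> gives a bound uniform in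
  \<open>t\<close>. It supplies the \<open>M\<close> of
  \<open>integral_by_parts_vanishing\<close>.\<close>

lemma kern_bounded:
  fixes f :: "real \<Rightarrow> real"
  assumes "0 < \<beta>" "continuous_on {0..T} f"
  obtains M where "\<And>t. t \<in> {0<..T} \<Longrightarrow> \<bar>kern \<beta> f t\<bar> \<le> M"
proof -
  obtain M where M: "M > 0" "\<And>x. x \<in> {0..T} \<Longrightarrow> \<bar>f x\<bar> \<le> M"
    using continuous_on_Icc_bounded[OF assms(2)] by blast
  have "\<bar>kern \<beta> f t\<bar> \<le> (\<integral>s. M * (indicator {0<..<T} s *\<^sub>R s powr (\<beta> - 1)) \<partial>lborel)"
    if t: "t \<in> {0<..T}" for t
  proof -
    have "norm (kern \<beta> f t) \<le> (\<integral>s. M * (indicator {0<..<T} s *\<^sub>R s powr (\<beta> - 1)) \<partial>lborel)"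
      unfolding kern_def set_lebesgue_integral_def
    proof (rule Bochner_Integration.integral_norm_bound_integral)
      show "integrable lborel (\<lambda>s. indicator {0<..<t} s *\<^sub>R (s powr (\<beta> - 1) * f (t - s)))"
        using kern_integrable[OF assms(1) _ assms(2), of t] t by (simp add: set_integrable_def)
      show "integrable lborel (\<lambda>s. M * (indicator {0<..<T} s *\<^sub>R s powr (\<beta> - 1)))"
        using set_integrable_powr_Ioo[OF assms(1), of T]
        unfolding set_integrable_def by (rule integrable_mult_right)
      show "norm (indicator {0<..<t} s *\<^sub>R (s powr (\<beta> - 1) * f (t - s)))
          \<le> M * (indicator {0<..<T} s *\<^sub>R s powr (\<beta> - 1))" for s
        using M(2)[of "t - s"] M(1) t
        by (auto simp: indicator_def abs_mult mult.commute[of M] intro!: mult_left_mono)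
    qed
    then show ?thesis by simp
  qed
  then show ?thesis using that by blast
qed

text \<open>Because \<open>u 0 = 0\<close>, differentiation under the integral produces no term from
  the moving upper limit. A bound on \<open>v\<close> is a Lipschitz constant of \<open>u\<close>,
  and this dominates the difference quotients.\<close>

lemma kern_deriv:
  fixes u v :: "real \<Rightarrow> real"
  assumes "0 < \<beta>" "u 0 = 0" "continuous_on {0..T} v"
    and u: "\<And>x. x \<in> {0..T} \<Longrightarrow> (u has_real_derivative v x) (at x within {0..T})"
    and t: "t \<in> {0<..T}"
  shows "(kern \<beta> u has_real_derivative kern \<beta> v t) (at t within {0<..T})"
proof -
  obtain M where M: "M > 0" "\<And>x. x \<in> {0..T} \<Longrightarrow> \<bar>v x\<bar> \<le> M"
    using continuous_on_Icc_bounded[OF assms(3)] by blast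
  have cont_u: "continuous_on {0..T} u"
    using u by (intro DERIV_continuous_on[of _ _ v]) auto
  \<comment> \<open>\<open>h\<close> extends \<open>u\<close> to negative arguments by
    \<open>u 0 = 0\<close>. The integrals for all \<open>x\<close> then run over the same interval
    \<open>{0<..<T}\<close>, and the Lipschitz bound persists.\<close>
  define h where "h x = u (max 0 x)" for x
  have lip: "\<bar>h x - h z\<bar> \<le> M * \<bar>x - z\<bar>" if "x \<le> T" "z \<le> T" for x z
  proof -
    have "norm (u (max 0 x) - u (max 0 z)) \<le> M * norm (max 0 x - max 0 z)"
      using that t M(2) by (intro field_differentiable_bound[of "{0..T}" u v] u) auto
    also have "\<dots> \<le> M * \<bar>x - z\<bar>" using M(1) by (intro mult_left_mono) auto
    finally show ?thesis by (simp add: h_def)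
  qed
  define k where "k s = indicator {0<..<T} s *\<^sub>R s powr (\<beta> - 1)" for s
  have int_k: "integrable lborel k"
    using set_integrable_powr_Ioo[OF assms(1), of T] by (simp add: k_def[abs_def] set_integrable_def)
  have k0: "0 \<le> k s" for s by (simp add: k_def)
  have k_eq: "indicator {0<..<x} s *\<^sub>R (s powr (\<beta> - 1) * u (x - s)) = k s * h (x - s)"
    if "x \<in> {0<..T}" for x s
    using that assms(2) by (auto simp: k_def h_def indicator_def max_def)
  have int_kh: "integrable lborel (\<lambda>s. k s * h (x - s))"
    and kern_u: "kern \<beta> u x = (\<integral>s. k s * h (x - s) \<partial>lborel)" if "x \<in> {0<..T}" for x
  proof -
    show "integrable lborel (\<lambda>s. k s * h (x - s))"
      using kern_integrable[OF assms(1) _ cont_u, of x] that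
      unfolding set_integrable_def k_eq[OF that] by simp
    show "kern \<beta> u x = (\<integral>s. k s * h (x - s) \<partial>lborel)"
      unfolding kern_def set_lebesgue_integral_def k_eq[OF that] ..
  qed
  have "((\<lambda>x. (kern \<beta> u x - kern \<beta> u t) / (x - t)) \<longlongrightarrow> kern \<beta> v t) (at t within {0<..T})"
    unfolding tendsto_at_iff_sequentially comp_def
  proof (intro allI impI)
    fix X :: "nat \<Rightarrow> real"
    assume "\<forall>n. X n \<in> {0<..T} - {t}" and lim: "X \<longlonglongrightarrow> t"
    then have X: "X n \<in> {0<..T}" "X n \<noteq> t" for n by auto
    define Q where "Q n s = k s * ((h (X n - s) - h (t - s)) / (X n - t))" for n s
    define q where "q s = indicator {0<..<t} s *\<^sub>R (s powr (\<beta> - 1) * v (t - s))" for s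
    have Q_eq: "Q n s = (k s * h (X n - s) - k s * h (t - s)) / (X n - t)" for n s
      by (simp add: Q_def field_simps)
    have int_Q: "integrable lborel (Q n)" for n
      unfolding Q_eq[abs_def] using int_kh[OF X(1)] int_kh[OF t]
      by (intro integrable_divide_zero Bochner_Integration.integrable_diff) auto
    have "(\<integral>s. Q n s \<partial>lborel) = (kern \<beta> u (X n) - kern \<beta> u t) / (X n - t)" for n
      unfolding Q_eq kern_u[OF X(1)] kern_u[OF t] using int_kh[OF X(1)] int_kh[OF t] by simp
    moreover have "(\<lambda>n. \<integral>s. Q n s \<partial>lborel) \<longlonglongrightarrow> (\<integral>s. q s \<partial>lborel)"
    proof (rule integral_dominated_convergence[where w = "\<lambda>s. M * k s"])
      show "q \<in> borel_measurable lborel"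
        using kern_integrable[OF assms(1) _ assms(3), of t] t
        by (simp add: q_def[abs_def] set_integrable_def)
      show "integrable lborel (\<lambda>s. M * k s)" using int_k by simp
      show "AE s in lborel. norm (Q n s) \<le> M * k s" for n
      proof (intro AE_I2)
        fix s
        show "norm (Q n s) \<le> M * k s"
        proof (cases "s \<in> {0<..<T}")
          case True
          then have "\<bar>h (X n - s) - h (t - s)\<bar> \<le> M * \<bar>X n - t\<bar>"
            using lip[of "X n - s" "t - s"] X(1)[of n] t by simp
          then have "\<bar>(h (X n - s) - h (t - s)) / (X n - t)\<bar> \<le> M"
            using X(2)[of n] by (simp add: abs_divide divide_le_eq)
          then show ?thesis
            unfolding Q_def real_norm_def abs_mult abs_of_nonneg[OF k0] mult.commute[of M]
            by (rule mult_left_mono) (rule k0)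
        qed (simp add: Q_def k_def)
      qed
      show "AE s in lborel. (\<lambda>n. Q n s) \<longlonglongrightarrow> q s"
        \<comment> \<open>At \<open>s = t\<close> the quotients are taken at the kink of
          \<open>h\<close> at 0 and may fail to converge; this single point is a null set.\<close>
        using AE_lborel_singleton[of t]
      proof eventually_elim
        fix s :: real
        assume "s \<noteq> t"
        have Xs: "(\<lambda>n. X n - s) \<longlonglongrightarrow> t - s" by (intro tendsto_intros lim)
        consider "s \<notin> {0<..<T}" | "s \<in> {0<..<T}" "s < t" | "s \<in> {0<..<T}" "t < s"
          using \<open>s \<noteq> t\<close> by fastforce
        then show "(\<lambda>n. Q n s) \<longlonglongrightarrow> q s"
        proof cases
          case 1
          then have "k s = 0" "q s = 0" using t by (auto simp: k_def q_def)
          then show ?thesis by (simp add: Q_def)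
        next
          case 2
          have ev: "\<forall>\<^sub>F n in sequentially. 0 < X n - s"
            using order_tendstoD(1)[OF Xs, of 0] 2 by simp
          have "filterlim (\<lambda>n. X n - s) (at (t - s) within {0..T}) sequentially"
            unfolding filterlim_at
          proof (intro conjI Xs)
            show "\<forall>\<^sub>F n in sequentially. X n - s \<in> {0..T} \<and> X n - s \<noteq> t - s"
              using ev
            proof eventually_elim
              case (elim n)
              then show ?case using X[of n] 2 by auto
            qed
          qed
          moreover have "((\<lambda>z. (u z - u (t - s)) / (z - (t - s))) \<longlongrightarrow> v (t - s)) (at (t - s) within {0..T})"
            using u[of "t - s"] 2 t unfolding has_field_derivative_iff by simp
          ultimately have "(\<lambda>n. (u (X n - s) - u (t - s)) / (X n - s - (t - s))) \<longlonglongrightarrow> v (t - s)"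
            by (rule filterlim_compose[rotated])
          moreover have "\<forall>\<^sub>F n in sequentially. (u (X n - s) - u (t - s)) / (X n - s - (t - s))
              = (h (X n - s) - h (t - s)) / (X n - t)"
            using ev by eventually_elim (use 2 in \<open>simp add: h_def max_def\<close>)
          ultimately have "(\<lambda>n. (h (X n - s) - h (t - s)) / (X n - t)) \<longlonglongrightarrow> v (t - s)"
            by (rule Lim_transform_eventually)
          then have "(\<lambda>n. Q n s) \<longlonglongrightarrow> k s * v (t - s)"
            unfolding Q_def by (intro tendsto_intros)
          also have "k s * v (t - s) = q s" using 2 by (simp add: k_def q_def)
          finally show ?thesis .
        next
          case 3
          have "\<forall>\<^sub>F n in sequentially. X n - s < 0"
            using order_tendstoD(2)[OF Xs, of 0] 3 by simp
          then have "\<forall>\<^sub>F n in sequentially. 0 = Q n s"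
            by eventually_elim (use 3 in \<open>simp add: Q_def h_def max_def\<close>)
          then have "(\<lambda>n. Q n s) \<longlonglongrightarrow> 0"
            by (rule Lim_transform_eventually[OF tendsto_const])
          then show ?thesis using 3 by (simp add: q_def)
        qed
      qed
    qed (use int_Q in auto)
    ultimately show "(\<lambda>n. (kern \<beta> u (X n) - kern \<beta> u t) / (X n - t)) \<longlonglongrightarrow> kern \<beta> v t"
      by (simp add: q_def[abs_def] kern_def set_lebesgue_integral_def)
  qed
  then show ?thesis by (simp add: has_field_derivative_iff)
qed

text \<open>On the triangle 0 < s < t < T the integrand is dominated by a constant times the kernel
  in \<open>s\<close>. Its integrability over the product gives both claims, with the order of
  integration exchanged.\<close>

lemma kern_Fubini:
  fixes a b :: "real \<Rightarrow> real"
  assumes "0 < \<beta>" "continuous_on UNIV a" "continuous_on UNIV b"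
  shows "set_integrable lborel {0<..<T} (\<lambda>t. a t * kern \<beta> b t)" (is ?int)
    and "(LINT t:{0<..<T}|lborel. a t * kern \<beta> b t)
      = (LINT s:{0<..<T}|lborel. s powr (\<beta> - 1) * (LINT t:{s<..<T}|lborel. a t * b (t - s)))" (is ?eq)
proof -
  have [measurable]: "a \<in> borel_measurable borel" "b \<in> borel_measurable borel"
    using assms by (auto intro: borel_measurable_continuous_onI)
  obtain A where A: "A > 0" "\<And>x. x \<in> {0..T} \<Longrightarrow> \<bar>a x\<bar> \<le> A"
    using continuous_on_Icc_bounded continuous_on_subset[OF assms(2)] by blast
  obtain B where B: "B > 0" "\<And>x. x \<in> {0..T} \<Longrightarrow> \<bar>b x\<bar> \<le> B"
    using continuous_on_Icc_bounded continuous_on_subset[OF assms(3)] by blast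
  define k where "k s = indicator {0<..<T} s *\<^sub>R s powr (\<beta> - 1)" for s
  have int_k: "integrable lborel k"
    using set_integrable_powr_Ioo[OF assms(1), of T] by (simp add: k_def[abs_def] set_integrable_def)
  then have [measurable]: "k \<in> borel_measurable borel" by auto
  define P where "P t s = (if 0 < s \<and> s < t \<and> t < T then k s * (a t * b (t - s)) else 0)" for t s
  have D: "integrable (lborel \<Otimes>\<^sub>M lborel) (\<lambda>(t, s). (A * B * indicator {0<..<T} t) * k s)"
  proof (rule lborel_pair.Fubini_integrable)
    show "AE t in lborel. integrable lborel (\<lambda>s. case (t, s) of (t, s) \<Rightarrow> A * B * indicator {0<..<T} t * k s)"
      using int_k by auto
    have "integrable lborel (\<lambda>t. \<bar>A * B * indicator {0<..<T} t\<bar> * (\<integral>s. \<bar>k s\<bar> \<partial>lborel))"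
      by (cases "0 \<le> T") (auto simp: abs_mult)
    then show "integrable lborel (\<lambda>t. \<integral>s. norm (case (t, s) of (t, s) \<Rightarrow> A * B * indicator {0<..<T} t * k s) \<partial>lborel)"
      by (simp add: abs_mult)
  qed measurable
  have P: "integrable (lborel \<Otimes>\<^sub>M lborel) (\<lambda>(t, s). P t s)"
  proof (rule Bochner_Integration.integrable_bound[OF D])
    show "(\<lambda>(t, s). P t s) \<in> borel_measurable (lborel \<Otimes>\<^sub>M lborel)"
      unfolding P_def by measurable
    have "norm (P t s) \<le> norm (A * B * indicator {0<..<T} t * k s)" for t s
    proof (cases "0 < s \<and> s < t \<and> t < T")
      case True
      then have "\<bar>a t * b (t - s)\<bar> \<le> A * B"
        unfolding abs_mult using A B by (intro mult_mono) auto
      then show ?thesis using True A(1) B(1)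
        by (simp add: P_def abs_mult mult.commute[of _ "\<bar>k s\<bar>"] mult_left_mono)
    qed (auto simp: P_def)
    then show "AE x in lborel \<Otimes>\<^sub>M lborel. norm (case x of (t, s) \<Rightarrow> P t s)
        \<le> norm (case x of (t, s) \<Rightarrow> A * B * indicator {0<..<T} t * k s)"
      by (intro AE_I2) auto
  qed
  have t: "(\<integral>s. P t s \<partial>lborel) = indicator {0<..<T} t *\<^sub>R (a t * kern \<beta> b t)" for t
  proof (cases "t \<in> {0<..<T}")
    case True
    have "P t s = a t * (indicator {0<..<t} s *\<^sub>R (s powr (\<beta> - 1) * b (t - s)))" for s
      using True by (auto simp: P_def k_def indicator_def)
    then show ?thesis using True by (simp add: kern_def set_lebesgue_integral_def)
  next
    case False
    then have "P t s = 0" for s by (auto simp: P_def)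
    then show ?thesis using False by simp
  qed
  have s: "(\<integral>t. P t s \<partial>lborel)
      = indicator {0<..<T} s *\<^sub>R (s powr (\<beta> - 1) * (LINT t:{s<..<T}|lborel. a t * b (t - s)))" for s
  proof -
    have "P t s = k s * (indicator {s<..<T} t *\<^sub>R (a t * b (t - s)))" for t
      by (auto simp: P_def k_def indicator_def)
    then show ?thesis by (simp add: k_def set_lebesgue_integral_def mult.assoc)
  qed
  show ?int
    using lborel_pair.integrable_fst'[OF P] by (simp add: t set_integrable_def)
  show ?eq
    using lborel_pair.Fubini_integral[OF P] unfolding t s by (simp add: set_lebesgue_integral_def)
qed

text \<open>After Fubini the inner integral of a(T - t) b(t - s) over s < t < T is symmetric in the
  two functions, by the reflection of t into T + s - t.\<close>

lemma kern_reflect: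
  fixes a b :: "real \<Rightarrow> real"
  assumes "0 < \<beta>" "continuous_on UNIV a" "continuous_on UNIV b"
  shows "(LINT t:{0<..<T}|lborel. a (T - t) * kern \<beta> b t) = (LINT t:{0<..<T}|lborel. b (T - t) * kern \<beta> a t)"
proof -
  have cont: "continuous_on UNIV (\<lambda>t. a (T - t))" "continuous_on UNIV (\<lambda>t. b (T - t))"
    by (rule continuous_on_compose2[OF assms(2)] continuous_on_compose2[OF assms(3)];
        auto intro!: continuous_intros)+
  have "(LINT t:{s<..<T}|lborel. a (T - t) * b (t - s)) = (LINT t:{s<..<T}|lborel. b (T - t) * a (t - s))" for s
  proof -
    have "indicator {s<..<T} (T + s + -1 * t) = (indicator {s<..<T} t :: real)" for t
      by (auto simp: indicator_def)
    then show ?thesis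
      unfolding set_lebesgue_integral_def
      by (subst lborel_integral_real_affine[where c = "-1" and t = "T + s"]) (auto simp: mult.commute)
  qed
  then show ?thesis
    by (simp add: kern_Fubini(2)[OF assms(1) cont(1) assms(3)] kern_Fubini(2)[OF assms(1) cont(2) assms(2)])
qed

section \<open>The integration by parts formula\<close>

text \<open>Existence and integrability on the right belong to the conclusion, since a
  non-integrable function would have the default integral 0 and the equality alone would not exclude
  this.\<close>

theorem theorem1:
  fixes T \<alpha> :: real and l :: nat and y g :: "real \<Rightarrow> real"
  assumes "T > 0" and "l \<ge> 1" and "real l - 1 \<le> \<alpha>" and "\<alpha> < real l"
    and "continuous_on UNIV y"
    and "RL_deriv_exists {0<..} \<alpha> y"
    and "set_integrable lborel {0<..<T} (\<lambda>t. g (T - t) * RL_deriv {0<..} \<alpha> y t)"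
    and "modulating_function l T g"
  shows "RL_deriv_exists {0<..T} \<alpha> g
    \<and> set_integrable lborel {0<..<T} (\<lambda>t. RL_deriv {0<..T} \<alpha> g t * y (T - t))
    \<and> (LINT t:{0<..<T}|lborel. g (T - t) * RL_deriv {0<..} \<alpha> y t)
      = (LINT t:{0<..<T}|lborel. RL_deriv {0<..T} \<alpha> g t * y (T - t))"
proof -
  define \<beta> where "\<beta> = real l - \<alpha>"
  have \<beta>: "0 < \<beta>" using assms by (simp add: \<beta>_def)
  have "\<lfloor>\<alpha>\<rfloor> = int l - 1" using assms by (intro floor_unique) auto
  then have order: "RL_order \<alpha> = l" using assms(2) by (simp add: RL_order_def)
  have RL: "RL_kernel_integral \<alpha> f = kern \<beta> f" for f
    by (rule ext) (simp add: RL_kernel_integral_eq_kern order \<beta>_def)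
  have Gpos: "Gamma \<beta> > 0" using \<beta> by (rule Gamma_real_pos)
  define q where "q j = iter_deriv {0..T} j g" for j
  have q: "deriv_chain {0..T} l q" and q0: "\<And>j. j < l \<Longrightarrow> q j 0 = 0" "\<And>j. j < l \<Longrightarrow> q j T = 0"
    using assms(8) C_class_on_deriv_chain by (auto simp: modulating_function_def q_def[abs_def])
  have g: "q 0 = g" by (simp add: q_def iter_deriv_def)
  have kern_q: "(kern \<beta> (q j) has_real_derivative kern \<beta> (q (Suc j)) x) (at x within {0<..T})"
    if "j < l" "x \<in> {0<..T}" for j x
    by (rule kern_deriv[OF \<beta>])
       (use that q0 deriv_chainD[OF q] deriv_chain_continuous_on[OF q] in auto)
  \<comment> \<open>Every point of \<open>{0<..T}\<close>, the endpoint \<open>T\<close> included,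
    is a limit of points of the set to its left.\<close>
  have nontriv: "at x within {0<..T} \<noteq> bot" if "x \<in> {0<..T}" for x
  proof -
    have "at x within {0..x} \<noteq> bot" "at x within {0<..x} = at x within {0..x}"
      using that by (auto simp: trivial_limit_within intro!: at_within_nhd[of x "{0<..}"])
    then show ?thesis
      using that by (metis at_le atLeastAtMost_iff greaterThanAtMost_iff le_bot subsetI order.trans)
  qed
  note I = nontriv kern_q
  have ex: "RL_deriv_exists {0<..T} \<alpha> g"
    unfolding RL_deriv_exists_def order RL
    by (rule times_differentiable_onI[where q = "\<lambda>j. kern \<beta> (q j)"]) (use I g in auto)
  \<comment> \<open>Clamping the argument to \<open>{0..T}\<close> makes the \<open>l\<close>-th
    derivative of \<open>g\<close> continuous on the whole line, as the Fubini lemmas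
    require.\<close>
  define G where "G x = q l (max 0 (min T x))" for x
  have cont_G: "continuous_on UNIV G"
    unfolding G_def
    by (rule continuous_on_compose2[OF deriv_chain_continuous_on[OF q order_refl]])
       (use assms(1) in \<open>auto intro!: continuous_intros\<close>)
  have G: "G x = q l x" if "x \<in> {0..T}" for x using that by (simp add: G_def)
  have RL_g: "RL_deriv {0<..T} \<alpha> g t = 1 / Gamma \<beta> * kern \<beta> G t" if "t \<in> {0<..<T}" for t
  proof -
    have "iter_deriv {0<..T} l (kern \<beta> g) t = kern \<beta> (q l) t"
      by (rule iter_deriv_eqI[where q = "\<lambda>j. kern \<beta> (q j)" and n = l]) (use I g that in auto)
    also have "\<dots> = kern \<beta> G t"
      using that by (intro kern_cong) (auto simp: G)
    finally show ?thesis by (simp add: RL_deriv_def order RL \<beta>_def)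
  qed
  have cont_y: "continuous_on UNIV (\<lambda>t. y (T - t))"
    by (rule continuous_on_compose2[OF assms(5)]) (auto intro!: continuous_intros)
  have int_g: "set_integrable lborel {0<..<T} (\<lambda>t. RL_deriv {0<..T} \<alpha> g t * y (T - t))"
  proof -
    have "set_integrable lborel {0<..<T} (\<lambda>t. 1 / Gamma \<beta> * (y (T - t) * kern \<beta> G t))"
      by (rule set_integrable_mult_right) (use kern_Fubini(1)[OF \<beta> cont_y cont_G] in auto)
    then show ?thesis
      by (rule set_integrable_cong[THEN iffD1, rotated -1]) (auto simp: RL_g)
  qed
  define f where "f j = iter_deriv {0<..} j (kern \<beta> y)" for j
  have f0: "f 0 = kern \<beta> y" by (simp add: f_def iter_deriv_def)
  have f: "(f j has_real_derivative f (Suc j) x) (at x within {0<..T})" if "j < l" "x \<in> {0<..T}" for j x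
    using times_differentiable_onD[of l "kern \<beta> y" "{0<..}" j x] assms(6) that
    by (auto simp: RL_deriv_exists_def order RL f_def intro: DERIV_subset)
  have RL_y: "RL_deriv {0<..} \<alpha> y t = 1 / Gamma \<beta> * f l t" for t
    by (simp add: RL_deriv_def order RL \<beta>_def f_def)
  obtain M where M: "\<And>t. t \<in> {0<..T} \<Longrightarrow> \<bar>kern \<beta> y t\<bar> \<le> M"
    using kern_bounded[OF \<beta> continuous_on_subset[OF assms(5)]] by blast
  \<comment> \<open>These are the successive derivatives of g(T - t); the sign comes from the chain
    rule.\<close>
  define p where "p j t = (-1) ^ j * q j (T - t)" for j t
  have p: "deriv_chain {0..T} l p"
    unfolding deriv_chain_def
  proof (intro conjI allI impI ballI)
    fix j x assume j: "j < l" "x \<in> {0..T}"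
    have "(\<lambda>t. T - t) ` {0..T} = {0..T}" by (auto simp: image_iff intro: bexI[of _ "T - _"])
    then have "(q j has_real_derivative q (Suc j) (T - x)) (at (T - x) within (\<lambda>t. T - t) ` {0..T})"
      using deriv_chainD[OF q, of j "T - x"] j by simp
    then have "((q j \<circ> (\<lambda>t. T - t)) has_real_derivative q (Suc j) (T - x) * (0 - 1)) (at x within {0..T})"
      by (rule DERIV_image_chain) (intro DERIV_diff DERIV_const DERIV_ident)
    from DERIV_cmult[OF this, of "(-1) ^ j"]
    show "(p j has_real_derivative p (Suc j) x) (at x within {0..T})"
      by (simp add: p_def[abs_def] comp_def)
  next
    show "continuous_on {0..T} (p l)"
      unfolding p_def
      by (rule continuous_on_mult_left, rule continuous_on_compose2[OF deriv_chain_continuous_on[OF q order_refl]])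
         (auto intro!: continuous_intros)
  qed
  have p_int: "set_integrable lborel {0<..<T} (\<lambda>t. p 0 t * f l t)"
  proof -
    have "set_integrable lborel {0<..<T} (\<lambda>t. Gamma \<beta> * (g (T - t) * RL_deriv {0<..} \<alpha> y t))"
      by (rule set_integrable_mult_right) (use assms(7) in auto)
    then show ?thesis using Gpos by (simp add: RL_y p_def g)
  qed
  have "(LINT t:{0<..<T}|lborel. g (T - t) * RL_deriv {0<..} \<alpha> y t)
      = (LINT t:{0<..<T}|lborel. 1 / Gamma \<beta> * (p 0 t * f l t))"
    by (simp add: RL_y p_def g)
  also have "\<dots> = 1 / Gamma \<beta> * (LINT t:{0<..<T}|lborel. p 0 t * f l t)"
    by (rule set_integral_mult_right)
  also have "(LINT t:{0<..<T}|lborel. p 0 t * f l t) = (-1) ^ l * (LINT t:{0<..<T}|lborel. p l t * f 0 t)"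
    by (rule integral_by_parts_vanishing[OF assms(1) _ p f _ _ _ p_int, where M = M])
       (use assms(2) q0 M in \<open>auto simp: p_def f0\<close>)
  also have "\<dots> = (LINT t:{0<..<T}|lborel. (-1) ^ l * (p l t * f 0 t))"
    by (rule set_integral_mult_right[symmetric])
  \<comment> \<open>The sign from the integrations by parts cancels the sign inside
    \<open>p l\<close>.\<close>
  also have "\<dots> = (LINT t:{0<..<T}|lborel. G (T - t) * kern \<beta> y t)"
    by (intro set_lebesgue_integral_cong) (auto simp: p_def f0 G simp flip: mult.assoc power_add)
  also have "\<dots> = (LINT t:{0<..<T}|lborel. y (T - t) * kern \<beta> G t)"
    by (rule kern_reflect[OF \<beta> cont_G assms(5)])
  also have "1 / Gamma \<beta> * \<dots> = (LINT t:{0<..<T}|lborel. 1 / Gamma \<beta> * (y (T - t) * kern \<beta> G t))"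
    by (rule set_integral_mult_right[symmetric])
  also have "\<dots> = (LINT t:{0<..<T}|lborel. RL_deriv {0<..T} \<alpha> g t * y (T - t))"
    by (intro set_lebesgue_integral_cong) (auto simp: RL_g)
  finally show ?thesis using ex int_g by blast
qed

end
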